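(* Let $X=\{x_1,\dots,x_m\}$, $m=|X|\ge 0$, be a sub-source of some source. Define $$\mathcal{R}^{*}_{\min}(X)=\min_{\{B\,\mid\, X\sqsubseteq B\}}\mathcal{R}_H(B),\qquad \mathcal{R}^{(\le n)}_{\min}(X)=\min_{\{B\,\mid\, X\sqsubseteq B,\ 2\le |B|\le n\}}\mathcal{R}_H(B),$$ where $B$ ranges over sources (of any finite size $|B|\ge 2$ in the first case). If $m\ge 1$, then $$\mathcal{R}^{*}_{\min}(X)=\mathcal{R}^{(\le \mathcal{T}(X))}_{\min}(X),\qquad\text{where}\quad \mathcal{T}(X)=|X|+\left\lceil\frac{1-\sum_{i=1}^m \mathrm{p}(x_i)}{\min\{\mathrm{p}(x_1),\dots,\mathrm{p}(x_m)\}}\right\rceil .$$ If $m=0$, then $\mathcal{R}^{*}_{\min}(X)=0$.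
   Context: All logarithms are base $2$. A (discrete memoryless) source $A$ of $n=|A|\ge 2$ symbols ($n$ finite) is an alphabet $\{a_1,\dots,a_n\}$ with probabilities $\mathrm{p}(a_i)>0$, $\sum_i \mathrm{p}(a_i)=1$. A sub-source $X$ of $A$, written $X\sqsubseteq A$, is a (possibly empty) subset of the symbols of $A$ together with their associated probabilities (which need not sum to $1$); $|X|$ is its number of symbols. For a source $B=\{b_1,\dots,b_n\}$ and a code $C$ with codeword lengths $\mathrm{l}_C(b_i)$, the redundancy is $\mathcal{R}_C(B)=\sum_i \mathrm{p}(b_i)\,\mathrm{l}_C(b_i)+\sum_i \mathrm{p}(b_i)\log \mathrm{p}(b_i)$. $\mathcal{R}_H(B)$ denotes the redundancy of a (binary) Huffman code $H$ for $B$; equivalently, the minimum of $\mathcal{R}_C(B)$ over all binary prefix-free codes $C$ for $B$. *)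

theory Defs
  imports Complex_Main "HOL-Library.Multiset" "HOL-Library.Infinite_Typeclass"
begin

text \<open>
  A source, and likewise a sub-source, is a partial map from symbols to probabilities whose
  domain is the alphabet. ``\<open>X\<close> is a sub-source of \<open>A\<close>'' is then the library's
  \<^term>\<open>X \<subseteq>\<^sub>m A\<close>: a subset of the symbols, with the same probabilities.
\<close>

abbreviation prob :: "('a \<rightharpoonup> real) \<Rightarrow> 'a \<Rightarrow> real" where
  "prob A a \<equiv> the (A a)"

definition is_source :: "('a \<rightharpoonup> real) \<Rightarrow> bool" where
  "is_source A \<longleftrightarrow>
     finite (dom A) \<and> card (dom A) \<ge> 2 \<and>
     (\<forall>a\<in>dom A. prob A a > 0) \<and> (\<Sum>a\<in>dom A. prob A a) = 1"

definition redundancy :: "('a \<Rightarrow> bool list) \<Rightarrow> ('a \<rightharpoonup> real) \<Rightarrow> real" where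
  "redundancy C B =
     (\<Sum>b\<in>dom B. prob B b * real (length (C b))) +
     (\<Sum>b\<in>dom B. prob B b * log 2 (prob B b))"

datatype 'a code_tree = Leaf 'a | Node "'a code_tree" "'a code_tree"

text \<open>
  In trees arising from the Huffman procedure every symbol labels exactly one leaf, so the case
  distinction in \<open>codeword\<close> finds the path from the root to the leaf of \<open>a\<close>.
\<close>

fun codeword :: "'a code_tree \<Rightarrow> 'a \<Rightarrow> bool list" where
  "codeword (Leaf b) a = []"
| "codeword (Node l r) a =
     (if a \<in> set_code_tree l then False # codeword l a else True # codeword r a)"

text \<open>
  The Huffman procedure on a forest of weighted trees, as a relation: two trees of least weight
  are repeatedly replaced by a common parent carrying the sum of their weights. Ties, and which
  of the two trees becomes the left subtree, are resolved arbitrarily.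
\<close>

inductive huffman_tree :: "(real \<times> 'a code_tree) multiset \<Rightarrow> 'a code_tree \<Rightarrow> bool" where
  single: "huffman_tree {#(w, t)#} t"
| merge: "huffman_tree (add_mset (u + v, Node s t) F) T \<Longrightarrow>
    (\<forall>(w, r) \<in># F. u \<le> w \<and> v \<le> w) \<Longrightarrow>
    huffman_tree (add_mset (u, s) (add_mset (v, t) F)) T"

definition huffman_code :: "('a \<rightharpoonup> real) \<Rightarrow> ('a \<Rightarrow> bool list) \<Rightarrow> bool" where
  "huffman_code B H \<longleftrightarrow>
     (\<exists>T. huffman_tree (image_mset (\<lambda>b. (prob B b, Leaf b)) (mset_set (dom B))) T \<and>
          (\<forall>b\<in>dom B. H b = codeword T b))"

text \<open>
  All Huffman codes for a source have the same redundancy: at each step the multiset of the two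
  least weights does not depend on how ties are resolved.
\<close>

definition huffman_redundancy :: "('a \<rightharpoonup> real) \<Rightarrow> real" where
  "huffman_redundancy B = (THE r. \<exists>H. huffman_code B H \<and> redundancy H B = r)"

definition extensions :: "('a \<rightharpoonup> real) \<Rightarrow> ('a \<rightharpoonup> real) set" where
  "extensions X = {B. is_source B \<and> X \<subseteq>\<^sub>m B}"

definition extensions_le :: "nat \<Rightarrow> ('a \<rightharpoonup> real) \<Rightarrow> ('a \<rightharpoonup> real) set" where
  "extensions_le n X = {B. is_source B \<and> X \<subseteq>\<^sub>m B \<and> 2 \<le> card (dom B) \<and> card (dom B) \<le> n}"

text \<open>
  \<open>LEAST\<close> on reals is the minimum only if the minimum is attained; that it is attained
  is expressed by \<open>min_attained\<close>.
\<close>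

definition min_attained :: "real set \<Rightarrow> bool" where
  "min_attained S \<longleftrightarrow> (\<exists>r\<in>S. \<forall>s\<in>S. r \<le> s)"

definition R_min_star :: "('a \<rightharpoonup> real) \<Rightarrow> real" where
  "R_min_star X = (LEAST r. r \<in> huffman_redundancy ` extensions X)"

definition R_min_le :: "nat \<Rightarrow> ('a \<rightharpoonup> real) \<Rightarrow> real" where
  "R_min_le n X = (LEAST r. r \<in> huffman_redundancy ` extensions_le n X)"

text \<open>
  For a non-empty sub-source of some source the ceiling below is non-negative, so \<^const>\<open>nat\<close>
  does not truncate.
\<close>

definition size_bound :: "('a \<rightharpoonup> real) \<Rightarrow> nat" where
  "size_bound X =
     card (dom X) +
     nat \<lceil>(1 - (\<Sum>x\<in>dom X. prob X x)) / Min (prob X ` dom X)\<rceil>"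

end

theory Submission imports Defs "HOL-Library.FuncSet" begin

text \<open>
  If \<open>B\<close> extends \<open>X\<close> and has more than \<open>size_bound X\<close> symbols, then at least two of the extra symbols
  are less likely than every symbol of \<open>X\<close>, so the two least likely symbols of \<open>B\<close> are extra ones.
  Replacing them by one symbol with probability \<open>u + v\<close> saves \<open>u + v\<close> in the expected
  length and costs at most \<open>u + v\<close> in the entropy, so the redundancy does not grow.

  The minimum over sources of bounded size is attained because, for fixed codeword lengths, the
  redundancy is least when the extra symbols \<open>e\<close> have probabilities proportional to
  \<open>2 ^ - length (H e)\<close>. That least value depends only on the codeword lengths on \<open>X\<close> and on the
  sum of \<open>2 ^ - length (H e)\<close>, so only finitely many values occur. By optimality of
  Huffman codes, the source with these modified probabilities has at most this redundancy.
\<close>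

section \<open>Costs of merging schedules\<close>

text \<open>
  \<open>merging M c\<close>: repeatedly merging two arbitrary weights of \<open>M\<close> into their sum can end in a single
  weight at total cost \<open>c\<close>. This is the expected length of a full binary tree code, without
  mentioning trees.
\<close>

inductive merging :: "real multiset \<Rightarrow> real \<Rightarrow> bool" where
  single: "merging {#w#} 0"
| merge: "merging (add_mset (u + v) W) c \<Longrightarrow> merging (add_mset u (add_mset v W)) (c + u + v)"

lemma merging_swap: "merging (add_mset y (add_mset x W)) c \<Longrightarrow> merging (add_mset x (add_mset y W)) c"
  by (simp add: add_mset_commute)

lemma merging_insert_merge:
  assumes "merging (add_mset x (add_mset (u + v) W)) c"
  shows "merging (add_mset x (add_mset u (add_mset v W))) (c + u + v)"
  using merging.merge[of u v "add_mset x W" c] assms by (simp add: add_mset_commute)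

text \<open>Serves to compare the pair merged first, \<open>u\<close> and \<open>v\<close>, with a
  distinguished pair \<open>x\<close>, \<open>y\<close>: the pairs coincide, share one occurrence
  (\<open>s\<close> being the partner of the shared weight), or are disjoint.\<close>

lemma two_add_mset_eq_cases:
  assumes "add_mset u (add_mset v F) = add_mset x (add_mset y W)"
  obtains
    (both) "{#u, v#} = {#x, y#}" "F = W"
  | (left) s G where "{#u, v#} = {#x, s#}" "F = add_mset y G" "W = add_mset s G"
  | (right) s G where "{#u, v#} = {#y, s#}" "F = add_mset x G" "W = add_mset s G"
  | (neither) G where "F = add_mset x (add_mset y G)" "W = add_mset u (add_mset v G)"
proof -
  consider "x = u" "add_mset v F = add_mset y W" | "x = v" "add_mset u F = add_mset y W"
    | F' where "F = add_mset x F'" "add_mset u (add_mset v F') = add_mset y W"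
    using assms by (auto simp: add_eq_conv_ex add_mset_commute)
  then show thesis
  proof cases
    case 1
    then consider "v = y" "F = W" | G where "F = add_mset y G" "W = add_mset v G"
      by (auto simp: add_eq_conv_ex)
    then show ?thesis using 1 both left[of v] by cases auto
  next
    case 2
    then consider "u = y" "F = W" | G where "F = add_mset y G" "W = add_mset u G"
      by (auto simp: add_eq_conv_ex)
    then show ?thesis using 2 both left[of u] by cases (auto simp: add_mset_commute)
  next
    case 3
    consider "u = y" "W = add_mset v F'" | "v = y" "W = add_mset u F'"
      | G where "F' = add_mset y G" "W = add_mset u (add_mset v G)"
      using 3(2) by (auto simp: add_eq_conv_ex add_mset_commute)
    then show ?thesis using 3(1) right[of v F'] right[of u F'] neither
      by cases (auto simp: add_mset_commute)
  qed
qed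

text \<open>\<open>d\<close> is the depth of the leaf carrying \<open>x\<close>.\<close>

lemma merging_linear:
  assumes "merging M c" "M = add_mset x W"
  shows "\<exists>d::real. \<forall>y. merging (add_mset y W) (c + (y - x) * d)"
  using assms
proof (induction arbitrary: x W rule: merging.induct)
  case (single w)
  then show ?case by (intro exI[of _ 0]) (auto intro: merging.single)
next
  case (merge u v F c)
  \<comment> \<open>If \<open>x\<close> takes part in the first merge, its leaf hangs one level
    below the node \<open>u + v\<close>, hence the depth \<open>d + 1\<close>.\<close>
  have tracked: ?case if uv: "{#u, v#} = {#x, s#}" and W: "W = add_mset s F" for s
  proof -
    have sum: "u + v = x + s" using uv by (auto simp: add_eq_conv_ex)
    obtain d where d: "merging (add_mset y F) (c + (y - (u + v)) * d)" for y
      using merge.IH[OF refl] by blast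
    have "merging (add_mset y W) (c + u + v + (y - x) * (d + 1))" for y
      using merging.merge[OF d[of "y + s"]] sum unfolding W by (simp add: algebra_simps)
    then show ?thesis by blast
  qed
  consider "u = x" "W = add_mset v F" | "v = x" "W = add_mset u F"
    | G where "F = add_mset x G" "W = add_mset u (add_mset v G)"
    using merge.prems by (auto simp: add_eq_conv_ex add_mset_commute)
  then show ?case
  proof cases
    case 1 then show ?thesis using tracked[of v] by simp
  next
    case 2 then show ?thesis using tracked[of u] by (simp add: add_mset_commute)
  next
    case 3
    obtain d where d: "merging (add_mset y (add_mset (u + v) G)) (c + (y - x) * d)" for y
      using merge.IH[of x "add_mset (u + v) G"] 3 by (auto simp: add_mset_commute)
    have "merging (add_mset y W) (c + u + v + (y - x) * d)" for y
      using merging_insert_merge[OF d[of y]] unfolding 3 by (simp add: algebra_simps)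
    then show ?thesis by blast
  qed
qed

text \<open>\<open>d\<close> and \<open>e\<close> are the depths of the two leaves in a fixed
  schedule. A leaf that takes part in the first merge lies one level below the new node.\<close>

lemma merging_linear2:
  assumes "merging M c" "M = add_mset x (add_mset y W)"
  shows "\<exists>d e::real. \<forall>x' y'. merging (add_mset x' (add_mset y' W)) (c + (x' - x) * d + (y' - y) * e)"
  using assms
proof (induction arbitrary: x y W rule: merging.induct)
  case (single w)
  then show ?case by simp
next
  case (merge u v F c)
  from merge.prems show ?case
  proof (cases rule: two_add_mset_eq_cases)
    case both
    have sum: "u + v = x + y" using both by (auto simp: add_eq_conv_ex)
    obtain d where d: "merging (add_mset z F) (c + (z - (u + v)) * d)" for z
      using merging_linear[OF merge.hyps refl] by blast
    have "merging (add_mset x' (add_mset y' W)) (c + u + v + (x' - x) * (d + 1) + (y' - y) * (d + 1))" for x' y'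
      using merging.merge[OF d[of "x' + y'"]] sum both by (simp add: algebra_simps)
    then show ?thesis by blast
  next
    case (left s G)
    have sum: "u + v = x + s" using left by (auto simp: add_eq_conv_ex)
    obtain d e where d: "merging (add_mset x' (add_mset y' G)) (c + (x' - (u + v)) * d + (y' - y) * e)" for x' y'
      using merge.IH[of "u + v" y G] left by auto
    have "merging (add_mset x' (add_mset y' W)) (c + u + v + (x' - x) * (d + 1) + (y' - y) * e)" for x' y'
      using merging.merge[OF d[of "x' + s" y']] sum unfolding left
      by (simp add: algebra_simps add_mset_commute)
    then show ?thesis by blast
  next
    case (right s G)
    have sum: "u + v = y + s" using right by (auto simp: add_eq_conv_ex)
    obtain d e where d: "merging (add_mset y' (add_mset x' G)) (c + (y' - (u + v)) * d + (x' - x) * e)" for x' y'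
      using merge.IH[of "u + v" x G] right by auto
    have "merging (add_mset x' (add_mset y' W)) (c + u + v + (x' - x) * e + (y' - y) * (d + 1))" for x' y'
      using merging.merge[OF d[of "y' + s" x']] sum unfolding right
      by (simp add: algebra_simps add_mset_commute)
    then show ?thesis by blast
  next
    case (neither G)
    obtain d e where d: "merging (add_mset x' (add_mset y' (add_mset (u + v) G)))
        (c + (x' - x) * d + (y' - y) * e)" for x' y'
      using merge.IH[of x y "add_mset (u + v) G"] neither by (auto simp: add_mset_commute)
    have "merging (add_mset x' (add_mset y' W)) (c + u + v + (x' - x) * d + (y' - y) * e)" for x' y'
      using merging.merge[of u v "add_mset x' (add_mset y' G)" "c + (x' - x) * d + (y' - y) * e"]
        d[of x' y'] unfolding neither
      by (simp add: algebra_simps add_mset_commute)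
    then show ?thesis by blast
  qed
qed

text \<open>With the schedule kept fixed, the deeper of the two leaves receives the smaller weight
  \<open>x\<close> and the other one receives \<open>y\<close>. Weight thus moves only to a leaf
  that is no deeper, so the cost does not rise.\<close>

lemma merging_spread:
  assumes "merging (add_mset x' (add_mset y' W)) c" "x + y = x' + y'" "x \<le> x'" "x \<le> y'"
  shows "\<exists>c'\<le>c. merging (add_mset x (add_mset y W)) c'"
proof -
  obtain d e where de: "merging (add_mset a (add_mset b W)) (c + (a - x') * d + (b - y') * e)" for a b
    using merging_linear2[OF assms(1) refl] by blast
  show ?thesis
  proof (cases "d \<ge> e")
    case True
    have diff: "y - y' = x' - x" using assms(2) by simp
    have "c + (x - x') * d + (y - y') * e = c - (x' - x) * (d - e)"
      unfolding diff by (simp add: algebra_simps)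
    moreover have "0 \<le> (x' - x) * (d - e)" using True assms(3) by simp
    ultimately show ?thesis using de[of x y] by (metis diff_le_eq le_add_same_cancel1)
  next
    case False
    have diff: "y - x' = y' - x" using assms(2) by simp
    have "c + (y - x') * d + (x - y') * e = c - (y' - x) * (e - d)"
      unfolding diff by (simp add: algebra_simps)
    moreover have "0 \<le> (y' - x) * (e - d)" using False assms(4) by simp
    ultimately show ?thesis using merging_swap[OF de[of y x]] by (metis diff_le_eq le_add_same_cancel1)
  qed
qed

text \<open>The exchange argument behind Huffman's optimality. Induction on the number of other
  weights compares the first merge of the given schedule with the pair \<open>u\<close>,
  \<open>v\<close>: a disjoint merge can be postponed, and one that shares a single weight is
  rearranged in \<open>mixed\<close>.\<close>

lemma merging_exchange:
  assumes "merging (add_mset u (add_mset v F)) c" "\<forall>w\<in>#F. u \<le> w \<and> v \<le> w" "0 \<le> u" "0 \<le> v"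
  shows "\<exists>c'. merging (add_mset (u + v) F) c' \<and> c' + u + v \<le> c"
  using assms
proof (induction "size F" arbitrary: u v F c rule: less_induct)
  case less
  define M where "M = add_mset u (add_mset v F)"
  have "merging M c" using less.prems M_def by simp
  then obtain a b G c1 where M: "M = add_mset a (add_mset b G)" and c: "c = c1 + a + b"
    and m1: "merging (add_mset (a + b) G) c1"
    by cases (auto simp: M_def)
  \<comment> \<open>The given schedule first joins \<open>x\<close>, one of the two least weights,
    to an outsider \<open>s\<close>, while \<open>y\<close> waits.\<close>
  have mixed: ?case
    if F: "F = add_mset s G'" and x: "x \<le> s" "y \<le> s" "0 \<le> x" "0 \<le> y" and uv: "{#u,v#} = {#x,y#}"
      and m: "merging (add_mset (x + s) (add_mset y G')) c1" and c: "c = c1 + x + s"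
    for x y s G'
  proof -
    have sum: "u + v = x + y" using uv by (auto simp: add_eq_conv_ex)
    have least: "\<forall>w\<in>#G'. x \<le> w \<and> y \<le> w" 
      using less.prems(2) F uv by (auto simp: add_eq_conv_ex)
    show ?thesis
    proof (cases "\<forall>w\<in>#G'. x + s \<le> w")
      case True
      \<comment> \<open>Now \<open>y\<close> and \<open>x + s\<close> are the two least weights, so
        by induction they can be merged next. Regrouping \<open>y + (x + s)\<close> as
        \<open>(x + y) + s\<close> makes the inner merge cost \<open>x + y\<close> instead of
        \<open>x + s\<close>.\<close>
      obtain c2 where c2: "merging (add_mset (y + (x + s)) G') c2" "c2 + y + (x + s) \<le> c1"
        using less.hyps[of G' y "x + s" c1] m True least x F by (auto simp: add_mset_commute)
      have "merging (add_mset (u + v) F) (c2 + (x + y) + s)"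
        using merging.merge[of "x + y" s G' c2] c2(1) unfolding F sum by (simp add: algebra_simps)
      then show ?thesis using c2(2) sum c x by (intro exI[of _ "c2 + (x + y) + s"]) auto
    next
      case False
      then have ne: "G' \<noteq> {#}" by auto
      \<comment> \<open>Here \<open>z\<close> is lighter than \<open>x + s\<close>, so by induction
        \<open>y\<close> and \<open>z\<close> can be merged next. The nodes \<open>y + z\<close> and
        \<open>x + s\<close> are then re-paired as \<open>x + y\<close> and \<open>z + s\<close>:
        the total is the same and \<open>x + y\<close> is at most either old node, so
        \<open>merging_spread\<close> applies.\<close>
      define z where "z = Min (set_mset G')"
      have z: "z \<in># G'" "\<forall>w\<in>#G'. z \<le> w" using ne by (auto simp: z_def)
      have zs: "z < x + s" using False z by force
      obtain G'' where G'': "G' = add_mset z G''" using z(1) by (metis insert_DiffM)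
      have m': "merging (add_mset y (add_mset z (add_mset (x + s) G''))) c1"
        using m unfolding G'' by (simp add: add_mset_commute)
      obtain c2 where c2: "merging (add_mset (y + z) (add_mset (x + s) G'')) c2" "c2 + y + z \<le> c1"
        using less.hyps[OF _ m'] z zs least x F G'' by fastforce
      obtain c3 where c3: "c3 \<le> c2" "merging (add_mset (x + y) (add_mset (z + s) G'')) c3"
        using merging_spread[OF c2(1), of "x + y" "z + s"] x least G'' by auto
      have "merging (add_mset (u + v) F) (c3 + z + s)"
        using merging_insert_merge[OF c3(2)] unfolding F G'' sum by (simp add: add_mset_commute)
      then show ?thesis using c2 c3 c sum by (intro exI[of _ "c3 + z + s"]) auto
    qed
  qed
  from M have "add_mset a (add_mset b G) = add_mset u (add_mset v F)" by (simp add: M_def)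
  then show ?case
  proof (cases rule: two_add_mset_eq_cases)
    case both
    then have "a + b = u + v" by (auto simp: add_eq_conv_ex)
    then show ?thesis using m1 c both by (intro exI[of _ c1]) auto
  next
    case (left s G')
    then have "a + b = u + s" by (auto simp: add_eq_conv_ex)
    then show ?thesis using mixed[of s G' u v] left m1 c less.prems by auto
  next
    case (right s G')
    then have "a + b = v + s" by (auto simp: add_eq_conv_ex)
    then show ?thesis using mixed[of s G' v u] right m1 c less.prems by (auto simp: add_mset_commute)
  next
    case (neither G')
    have m: "merging (add_mset u (add_mset v (add_mset (a + b) G'))) c1"
      using m1 neither by (simp add: add_mset_commute)
    obtain c2 where c2: "merging (add_mset (u + v) (add_mset (a + b) G')) c2" "c2 + u + v \<le> c1"
      using less.hyps[OF _ m] neither less.prems by fastforce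
    then show ?thesis using merging_insert_merge[OF c2(1)] c neither
      by (intro exI[of _ "c2 + a + b"]) auto
  qed
qed

section \<open>Code trees and the optimality of Huffman trees\<close>

fun leaves :: "'a code_tree \<Rightarrow> 'a multiset" where
  "leaves (Leaf a) = {#a#}"
| "leaves (Node l r) = leaves l + leaves r"

definition weight :: "('a \<Rightarrow> real) \<Rightarrow> 'a code_tree \<Rightarrow> real" where
  "weight p t = (\<Sum>a\<in>#leaves t. p a)"

text \<open>The total weight of all internal nodes, a form of the weighted path length that grows by
  \<open>u + v\<close> per merge just as in \<open>merging\<close>.\<close>

fun cost :: "('a \<Rightarrow> real) \<Rightarrow> 'a code_tree \<Rightarrow> real" where
  "cost p (Leaf a) = 0"
| "cost p (Node l r) = cost p l + cost p r + weight p l + weight p r"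

lemma weight_simps [simp]:
  "weight p (Leaf a) = p a" "weight p (Node l r) = weight p l + weight p r"
  by (simp_all add: weight_def)

lemma set_mset_leaves [simp]: "set_mset (leaves t) = set_code_tree t"
  by (induction t) auto

text \<open>Every step of the path discards a sibling subtree, which has at least one leaf.\<close>

lemma length_codeword_less: "length (codeword t a) < size (leaves t)"
proof (induction t)
  case (Node l r)
  then show ?case by (cases "size (leaves l)"; cases "size (leaves r)") auto
qed simp

text \<open>An internal node contributes one bit to the codeword of each leaf below it. Repeated
  symbols would break this, since \<open>codeword\<close> turns left whenever the symbol occurs on
  the left.\<close>

lemma cost_eq_sum_length:
  assumes "\<And>a. count (leaves t) a \<le> 1"
  shows "cost p t = (\<Sum>a\<in>#leaves t. p a * real (length (codeword t a)))"
  using assms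
proof (induction t)
  case (Node l r)
  have "count (leaves l) a \<le> 1" "count (leaves r) a \<le> 1" for a
    using Node.prems[of a] by auto
  note IH = Node.IH(1)[OF this(1)] Node.IH(2)[OF this(2)]
  have disj: "a \<notin> set_code_tree l" if "a \<in># leaves r" for a
  proof
    assume "a \<in> set_code_tree l"
    then have "count (leaves l) a \<ge> 1" "count (leaves r) a \<ge> 1"
      using that by (simp_all add: Suc_le_eq)
    then have "1 + 1 \<le> count (leaves (Node l r)) a" by (simp only: leaves.simps count_union add_mono)
    then show False using Node.prems[of a] by linarith
  qed
  have "(\<Sum>a\<in>#leaves l. p a * real (length (codeword (Node l r) a))) = cost p l + weight p l"
    unfolding IH weight_def by (subst sum_mset.distrib[symmetric])
      (intro arg_cong[of _ _ sum_mset] image_mset_cong, auto simp: algebra_simps)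
  moreover have "(\<Sum>a\<in>#leaves r. p a * real (length (codeword (Node l r) a))) = cost p r + weight p r"
    unfolding IH weight_def by (subst sum_mset.distrib[symmetric])
      (intro arg_cong[of _ _ sum_mset] image_mset_cong, use disj in \<open>auto simp: algebra_simps\<close>)
  ultimately show ?case by simp
qed simp

text \<open>
  The weights \<open>p\<close> here need not be those that guided the Huffman procedure; this allows a Huffman
  tree of one source to be compared with the optimum for another.
\<close>

lemma huffman_tree_merging:
  assumes "huffman_tree F T"
  shows "merging (image_mset (\<lambda>(w, t). weight p t) F) (cost p T - (\<Sum>(w, t)\<in>#F. cost p t))"
  using assms
proof (induction rule: huffman_tree.induct)
  case (single w t)
  then show ?case by (simp add: merging.single)
next
  case (merge u v s t F T)
  then show ?case using merging.merge[of "weight p s" "weight p t"] by (fastforce simp: algebra_simps)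
qed

text \<open>At every step \<open>merging_exchange\<close> lets the competing schedule begin with the
  pair chosen by the procedure. The costs inside the trees of the forest are subtracted because only
  merges still to come are compared.\<close>

lemma huffman_tree_optimal:
  assumes "huffman_tree F T" "\<forall>(w, t)\<in>#F. w = weight p t \<and> 0 \<le> w" "merging (image_mset fst F) c"
  shows "cost p T - (\<Sum>(w, t)\<in>#F. cost p t) \<le> c"
  using assms
proof (induction arbitrary: c rule: huffman_tree.induct)
  case (single w t)
  from single.prems(2) have "c = 0" by cases auto
  then show ?case by simp
next
  case (merge u v s t F T)
  obtain c' where c': "merging (add_mset (u + v) (image_mset fst F)) c'" "c' + u + v \<le> c"
    using merging_exchange[of u v "image_mset fst F" c] merge by force
  show ?case using merge.IH[of c'] c' merge.prems by simp
qed

lemma huffman_tree_leaves: "huffman_tree F T \<Longrightarrow> leaves T = (\<Sum>(w, t)\<in>#F. leaves t)"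
  by (induction rule: huffman_tree.induct) (auto simp: ac_simps)

lemma least_in_mset:
  fixes f :: "'b \<Rightarrow> real"
  assumes "M \<noteq> {#}"
  obtains x N where "M = add_mset x N" "\<forall>y\<in>#M. f x \<le> f y"
proof -
  have "Min (f ` set_mset M) \<in> f ` set_mset M" using assms by (intro Min_in) auto
  then obtain x where x: "x \<in># M" "f x = Min (f ` set_mset M)" by auto
  then show thesis using that[of x "M - {#x#}"] by auto
qed

lemma huffman_tree_exists: "F \<noteq> {#} \<Longrightarrow> \<exists>T. huffman_tree F T"
proof (induction "size F" arbitrary: F rule: less_induct)
  case less
  obtain x G where x: "F = add_mset x G" "\<forall>y\<in>#F. fst x \<le> fst y"
    using least_in_mset[OF less.prems, of fst] by metis
  obtain u s where us: "x = (u, s)" by (cases x)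
  show ?case
  proof (cases "G = {#}")
    case True then show ?thesis using x us huffman_tree.single by auto
  next
    case False
    obtain y K where y: "G = add_mset y K" "\<forall>z\<in>#G. fst y \<le> fst z"
      using least_in_mset[OF False, of fst] by metis
    obtain v t where vt: "y = (v, t)" by (cases y)
    obtain T where "huffman_tree (add_mset (u + v, Node s t) K) T"
      using less.hyps[of "add_mset (u + v, Node s t) K"] x y by auto
    then have "huffman_tree (add_mset (u, s) (add_mset (v, t) K)) T"
      by (rule huffman_tree.merge) (use x y us vt in fastforce)
    then show ?thesis using x y us vt by auto
  qed
qed

section \<open>Huffman redundancy as an optimum over merging schedules\<close>

abbreviation prob_mset :: "('a \<rightharpoonup> real) \<Rightarrow> real multiset" where
  "prob_mset B \<equiv> image_mset (prob B) (mset_set (dom B))"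

abbreviation neg_entropy :: "('a \<rightharpoonup> real) \<Rightarrow> real" where
  "neg_entropy B \<equiv> (\<Sum>b\<in>dom B. prob B b * log 2 (prob B b))"

lemma is_source_nonempty: "is_source B \<Longrightarrow> dom B \<noteq> {}"
  by (auto simp: is_source_def)

lemma finite_dom_sub_source: "is_source B \<Longrightarrow> X \<subseteq>\<^sub>m B \<Longrightarrow> finite (dom X)"
  using finite_subset[OF map_le_implies_dom_le, of X B] by (simp add: is_source_def)

lemma huffman_code_exists:
  assumes "is_source B"
  shows "\<exists>H. huffman_code B H"
proof -
  have "image_mset (\<lambda>b. (prob B b, Leaf b)) (mset_set (dom B)) \<noteq> {#}"
    using assms is_source_nonempty[OF assms] by (simp add: is_source_def mset_set_empty_iff)
  then show ?thesis using huffman_tree_exists unfolding huffman_code_def by blast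
qed

lemma huffman_code_length:
  assumes "finite (dom B)" "huffman_code B H" "b \<in> dom B"
  shows "length (H b) \<le> card (dom B)"
proof -
  obtain T where T: "huffman_tree (image_mset (\<lambda>b. (prob B b, Leaf b)) (mset_set (dom B))) T"
    and H: "\<forall>b\<in>dom B. H b = codeword T b"
    using assms unfolding huffman_code_def by blast
  have "leaves T = mset_set (dom B)"
    using huffman_tree_leaves[OF T] by (simp add: multiset.map_comp comp_def)
  then show ?thesis using length_codeword_less[of T b] H assms by simp
qed

text \<open>Arbitrary weights \<open>p\<close> in the first fact let the code of one source be
  priced with the probabilities of another, as in \<open>improve_extra_probabilities\<close>. The
  second fact carries the optimality.\<close>

lemma huffman_code_merging:
  assumes "finite (dom B)" "huffman_code B H"
  shows "merging (image_mset p (mset_set (dom B))) (\<Sum>b\<in>dom B. p b * real (length (H b)))"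
    and "\<lbrakk>\<forall>b\<in>dom B. 0 \<le> prob B b; merging (prob_mset B) c\<rbrakk> \<Longrightarrow>
      (\<Sum>b\<in>dom B. prob B b * real (length (H b))) \<le> c"
proof -
  let ?F = "image_mset (\<lambda>b. (prob B b, Leaf b)) (mset_set (dom B))"
  obtain T where T: "huffman_tree ?F T"
    and H: "\<forall>b\<in>dom B. H b = codeword T b"
    using assms unfolding huffman_code_def by blast
  have lT: "leaves T = mset_set (dom B)"
    using huffman_tree_leaves[OF T] by (simp add: multiset.map_comp comp_def)
  have len: "cost q T = (\<Sum>b\<in>dom B. q b * real (length (H b)))" for q
    using cost_eq_sum_length[of T q] H unfolding lT
    by (simp add: sum_unfold_sum_mset count_mset_set' assms(1) cong: image_mset_cong)
  show "merging (image_mset p (mset_set (dom B))) (\<Sum>b\<in>dom B. p b * real (length (H b)))"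
    using huffman_tree_merging[OF T, of p] len by (simp add: multiset.map_comp comp_def)
  show "(\<Sum>b\<in>dom B. prob B b * real (length (H b))) \<le> c"
    if "\<forall>b\<in>dom B. 0 \<le> prob B b" "merging (prob_mset B) c"
    using huffman_tree_optimal[OF T, of "prob B" c] len that assms(1)
    by (simp add: multiset.map_comp comp_def)
qed

text \<open>Each of two Huffman codes yields a schedule, so each expected length bounds the other.
  This makes the \<open>THE\<close> in \<open>huffman_redundancy\<close> well defined.\<close>

lemma huffman_redundancy_eq:
  assumes "is_source B" "huffman_code B H"
  shows "huffman_redundancy B = redundancy H B"
proof -
  have fin: "finite (dom B)" and nn: "\<forall>b\<in>dom B. 0 \<le> prob B b"
    using assms by (auto simp: is_source_def intro: less_imp_le)
  have "redundancy H' B = redundancy H B" if "huffman_code B H'" for H'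
    using huffman_code_merging[OF fin that] huffman_code_merging[OF fin assms(2)] nn
    unfolding redundancy_def by (intro arg_cong2[of _ _ _ _ "(+)"] antisym) auto
  then show ?thesis unfolding huffman_redundancy_def using assms(2) by (intro the_equality) blast+
qed

text \<open>Together with \<open>huffman_redundancy_attained\<close> this identifies the redundancy
  as the least merging cost plus \<open>neg_entropy B\<close>, so upper bounds reduce to exhibiting
  schedules.\<close>

lemma huffman_redundancy_le:
  assumes "is_source B" "merging (prob_mset B) c"
  shows "huffman_redundancy B \<le> c + neg_entropy B"
proof -
  obtain H where H: "huffman_code B H" using huffman_code_exists assms by blast
  show ?thesis unfolding huffman_redundancy_eq[OF assms(1) H] redundancy_def
    using huffman_code_merging(2)[OF _ H _ assms(2)] assms by (auto simp: is_source_def intro: less_imp_le)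
qed

lemma huffman_redundancy_attained:
  assumes "is_source B"
  obtains c where "merging (prob_mset B) c" "huffman_redundancy B = c + neg_entropy B"
proof -
  obtain H where H: "huffman_code B H" using huffman_code_exists assms by blast
  then show ?thesis using that huffman_redundancy_eq[OF assms(1) H] 
    huffman_code_merging(1)[OF _ H, of "prob B"] assms by (auto simp: is_source_def redundancy_def)
qed

section \<open>Entropy inequalities\<close>

text \<open>Follows from \<open>ln y \<le> y - 1\<close> at
  \<open>y = (k e * Q) / (K * q e)\<close>. It is applied with \<open>k e = 1 / 2\<close> to merge
  two probabilities and with \<open>k e = (1 / 2) ^ length (H e)\<close> to redistribute the extra
  ones.\<close>

lemma log_sum_inequality:
  assumes "finite E" "\<And>e. e \<in> E \<Longrightarrow> 0 < q e" "\<And>e. e \<in> E \<Longrightarrow> 0 < k e"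
  shows "sum q E * log 2 (sum q E / sum k E) \<le> (\<Sum>e\<in>E. q e * log 2 (q e / k e))"
proof (cases "E = {}")
  case False
  define Q K where "Q = sum q E" and "K = sum k E"
  have QK: "0 < Q" "0 < K" using assms False by (auto simp: Q_def K_def intro: sum_pos)
  have "q e * (ln (Q / K) - ln (q e / k e)) \<le> k e * Q / K - q e" if e: "e \<in> E" for e
  proof -
    note pos = assms(2,3)[OF e] QK
    have "ln (Q / K) - ln (q e / k e) = ln ((k e * Q) / (K * q e))"
      using pos by (simp add: ln_div ln_mult)
    also have "\<dots> \<le> (k e * Q) / (K * q e) - 1" using pos by (intro ln_le_minus_one) simp
    finally show ?thesis using mult_left_mono[of _ _ "q e"] pos by (force simp: field_simps)
  qed
  then have "(\<Sum>e\<in>E. q e * (ln (Q / K) - ln (q e / k e))) \<le> (\<Sum>e\<in>E. k e * Q / K - q e)"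
    by (intro sum_mono)
  \<comment> \<open>The right-hand side is written so that it visibly cancels to 0.\<close>
  then have "(\<Sum>e\<in>E. q e * (ln (Q / K) - ln (q e / k e))) \<le> K * Q / K - Q"
    by (simp only: sum_subtractf sum_divide_distrib[symmetric] sum_distrib_right[symmetric]
        Q_def[symmetric] K_def[symmetric])
  then have "Q * ln (Q / K) \<le> (\<Sum>e\<in>E. q e * ln (q e / k e))"
    using QK by (simp add: right_diff_distrib sum_subtractf flip: sum_distrib_right Q_def)
  then show ?thesis
    by (simp add: log_def divide_right_mono flip: sum_divide_distrib Q_def K_def)
qed simp

text \<open>A choice between two alternatives carries at most one bit: the log-sum inequality over
  the two booleans, with both reference weights \<open>1 / 2\<close>.\<close>

lemma entropy_merge_le:
  fixes u v :: real
  assumes "0 < u" "0 < v"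
  shows "(u + v) * log 2 (u + v) \<le> u + v + u * log 2 u + v * log 2 v"
proof -
  have "log 2 (x / (1 / 2)) = 1 + log 2 x" if "0 < x" for x :: real
    using that log_mult[of 2 x 2] by simp
  moreover have "sum (\<lambda>b. if b then u else v) (UNIV :: bool set) *
      log 2 (sum (\<lambda>b. if b then u else v) (UNIV :: bool set) / sum (\<lambda>_. 1 / 2) (UNIV :: bool set))
    \<le> (\<Sum>b\<in>UNIV. (if b then u else v) * log 2 ((if b then u else v) / (1 / 2)))"
    using assms by (intro log_sum_inequality) auto
  ultimately show ?thesis using assms by (simp add: UNIV_bool distrib_left add.commute)
qed

text \<open>Each merge costs \<open>u + v\<close>, which pays for the entropy it destroys, and the
  last remaining weight is the total. For total weight 1 the left side vanishes, giving the source
  coding bound.\<close>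

lemma merging_lower_bound:
  assumes "merging M c" "\<forall>w\<in>#M. 0 < w"
  shows "sum_mset M * log 2 (sum_mset M) \<le> c + (\<Sum>w\<in>#M. w * log 2 w)"
  using assms
proof (induction rule: merging.induct)
  case (merge u v W c)
  then have "(u + v) * log 2 (u + v) \<le> u + v + u * log 2 u + v * log 2 v"
    by (intro entropy_merge_le) auto
  then show ?case using merge by (simp add: add.assoc)
qed simp

lemma huffman_redundancy_nonneg:
  assumes "is_source B"
  shows "0 \<le> huffman_redundancy B"
proof -
  obtain c where c: "merging (prob_mset B) c" "huffman_redundancy B = c + neg_entropy B"
    using huffman_redundancy_attained[OF assms] .
  then show ?thesis using merging_lower_bound[OF c(1)] assms
    by (simp add: is_source_def sum_unfold_sum_mset multiset.map_comp comp_def)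
qed

text \<open>Codewords of length 1 match the ideal length \<open>- log 2 (1 / 2)\<close>. This source
  is the minimiser for the empty sub-source.\<close>

lemma huffman_redundancy_uniform_pair:
  assumes "a \<noteq> b" and B: "B = [a \<mapsto> 1 / 2, b \<mapsto> 1 / 2]"
  shows "is_source B" "huffman_redundancy B = 0"
proof -
  have dom: "dom B = {a, b}" by (auto simp: B)
  show source: "is_source B" unfolding is_source_def dom using assms by simp
  have "merging {#1 / 2, 1 / 2#} 1"
    using merging.merge[OF merging.single, of "1/2" "1/2"] by simp
  then have "huffman_redundancy B \<le> 0"
    using huffman_redundancy_le[OF source, of 1] unfolding dom using assms
    by (simp add: log_divide)
  then show "huffman_redundancy B = 0" using huffman_redundancy_nonneg[OF source] by simp
qed

section \<open>Reduction to sources of bounded size\<close>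

text \<open>An optimal schedule for \<open>B\<close> may start by joining \<open>a\<close> and
  \<open>b\<close>; dropping that merge saves \<open>prob B a + prob B b\<close>, which covers the
  loss of entropy. Three symbols are required so that \<open>B'\<close> keeps the two that
  \<open>is_source\<close> demands.\<close>

lemma merge_two_least:
  assumes B: "is_source B" "3 \<le> card (dom B)" and ab: "a \<in> dom B" "b \<in> dom B" "a \<noteq> b"
    and least: "\<And>x. x \<in> dom B - {a, b} \<Longrightarrow> prob B a \<le> prob B x \<and> prob B b \<le> prob B x"
    and B': "B' = B(a \<mapsto> prob B a + prob B b, b := None)"
  shows "is_source B'" "huffman_redundancy B' \<le> huffman_redundancy B"
proof -
  define R where "R = dom B - {a, b}"
  define u v where "u = prob B a" and "v = prob B b"
  have fin: "finite R" and R: "a \<notin> R" "b \<notin> R" using B by (auto simp: R_def is_source_def)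
  have dom: "dom B = insert a (insert b R)" "dom B' = insert a R"
    using ab by (auto simp: R_def B')
  have same: "prob B' x = prob B x" if "x \<in> R" for x using that R by (auto simp: B')
  have new: "prob B' a = u + v" using ab by (simp add: B' u_def v_def)
  have pos: "\<forall>x\<in>dom B. 0 < prob B x" "0 < u" "0 < v" 
    using B ab by (auto simp: is_source_def u_def v_def)
  \<comment> \<open>\<open>f\<close> will be the identity for the total probability and
    \<open>\<lambda>p. p * log 2 p\<close> for the entropy.\<close>
  have sums: "(\<Sum>x\<in>dom B. f (prob B x)) = f u + f v + (\<Sum>x\<in>R. f (prob B x))"
    "(\<Sum>x\<in>dom B'. f (prob B' x)) = f (u + v) + (\<Sum>x\<in>R. f (prob B x))" for f :: "real \<Rightarrow> real"
    using R ab(3) fin unfolding dom by (simp_all add: same new u_def v_def)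
  have "card (dom B) = Suc (card (dom B'))" using R ab(3) fin unfolding dom by simp
  then show source: "is_source B'"
    using B pos sums(1)[of "\<lambda>x. x"] sums(2)[of "\<lambda>x. x"] fin
    unfolding is_source_def by (auto simp: dom same new)
  have msets: "prob_mset B = add_mset u (add_mset v (image_mset (prob B) (mset_set R)))"
    "prob_mset B' = add_mset (u + v) (image_mset (prob B) (mset_set R))"
  proof -
    have "image_mset (prob B') (mset_set R) = image_mset (prob B) (mset_set R)"
      using fin same by (intro image_mset_cong) simp
    then show "prob_mset B = add_mset u (add_mset v (image_mset (prob B) (mset_set R)))"
      "prob_mset B' = add_mset (u + v) (image_mset (prob B) (mset_set R))"
      using R ab(3) fin new unfolding dom by (simp_all add: u_def v_def)
  qed
  obtain c where c: "merging (prob_mset B) c" "huffman_redundancy B = c + neg_entropy B"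
    using huffman_redundancy_attained[OF B(1)] .
  obtain c' where c': "merging (prob_mset B') c'" "c' + u + v \<le> c"
    using merging_exchange[OF c(1)[unfolded msets]] least pos fin
    unfolding msets by (auto simp: R_def u_def v_def less_imp_le)
  show "huffman_redundancy B' \<le> huffman_redundancy B"
    using huffman_redundancy_le[OF source c'(1)] c(2) c'(2) entropy_merge_le[OF pos(2,3)]
      sums[of "\<lambda>p. p * log 2 p"] by linarith
qed

text \<open>A pigeonhole argument on the extra symbols \<open>E\<close> with total probability
  \<open>t\<close>: when their number exceeds \<open>t / m\<close> rounded up, two of them lie below
  \<open>m\<close>, the least probability in \<open>X\<close>.\<close>

lemma two_small_extra_symbols:
  assumes X: "dom X \<noteq> {}" and B: "B \<in> extensions X" and big: "size_bound X < card (dom B)"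
  obtains a b where "a \<in> dom B - dom X" "b \<in> dom B - dom X" "a \<noteq> b"
    "\<And>x. x \<in> dom B - {a, b} \<Longrightarrow> prob B a \<le> prob B x \<and> prob B b \<le> prob B x"
proof -
  define E where "E = dom B - dom X"
  define m where "m = Min (prob X ` dom X)"
  define t where "t = 1 - (\<Sum>x\<in>dom X. prob X x)"
  have B': "is_source B" "X \<subseteq>\<^sub>m B" using B by (auto simp: extensions_def)
  have sub: "dom X \<subseteq> dom B" using B'(2) by (simp add: map_le_implies_dom_le)
  have same: "prob X x = prob B x" if "x \<in> dom X" for x using B'(2) that by (simp add: map_le_def)
  have fin: "finite (dom B)" "finite (dom X)" "finite E" 
    using B' sub finite_subset by (auto simp: is_source_def E_def)
  have pos: "\<And>x. x \<in> dom B \<Longrightarrow> 0 < prob B x" using B' by (auto simp: is_source_def)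
  have imX: "prob X ` dom X = prob B ` dom X" using same by (intro image_cong) auto
  have m: "0 < m" "\<And>x. x \<in> dom X \<Longrightarrow> m \<le> prob B x"
  proof -
    have "m \<in> prob B ` dom X" unfolding m_def imX using X fin(2) by (intro Min_in) auto
    then show "0 < m" using pos sub by blast
    show "m \<le> prob B x" if "x \<in> dom X" for x
      unfolding m_def imX using that fin(2) by (intro Min_le) auto
  qed
  have "(\<Sum>x\<in>dom X. prob X x) = (\<Sum>x\<in>dom X. prob B x)" using same by (intro sum.cong) auto
  then have t: "t = (\<Sum>x\<in>E. prob B x)"
    using B'(1) sum.subset_diff[OF sub fin(1), of "prob B"] unfolding t_def E_def is_source_def by linarith
  have cardE: "card (dom B) = card (dom X) + card E"
    using sub fin by (simp add: E_def card_Diff_subset card_mono)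
  have k: "nat \<lceil>t / m\<rceil> < card E" using big cardE by (simp add: size_bound_def t_def m_def)
  then have ne: "E \<noteq> {}" by auto
  \<comment> \<open>\<open>card E\<close> is an integer above the ceiling, so even
    \<open>card E - 1\<close> is at least \<open>t / m\<close>.\<close>
  have tm: "t \<le> (real (card E) - 1) * m"
  proof -
    have "t / m \<le> real (nat \<lceil>t / m\<rceil>)" by linarith
    also have "\<dots> \<le> real (card E) - 1" using k by linarith
    finally show ?thesis using m(1) by (simp add: field_simps)
  qed
  define a where "a = arg_min_on (prob B) E"
  have a: "a \<in> E" "\<And>x. x \<in> E \<Longrightarrow> prob B a \<le> prob B x"
    using arg_min_if_finite(1)[OF fin(3) ne, of "prob B"] arg_min_least[OF fin(3) ne, of _ "prob B"] 
    by (auto simp: a_def)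
  \<comment> \<open>Removing the positive \<open>prob B a\<close> makes the bound strict, so the
    remaining \<open>card E - 1\<close> symbols average below \<open>m\<close>.\<close>
  have small: "(\<Sum>x\<in>E - {a}. prob B x) < (real (card E) - 1) * m"
    using tm t a(1) sum.remove[OF fin(3) a(1), of "prob B"] pos[of a] by (auto simp: E_def)
  \<comment> \<open>With a single extra symbol, \<open>small\<close> would read
    \<open>0 < 0\<close>.\<close>
  have ne': "E - {a} \<noteq> {}" 
  proof
    assume none: "E - {a} = {}"
    then have "card E = 1" using a(1) by (metis Diff_eq_empty_iff insert_absorb is_singletonI
        is_singleton_altdef subset_singletonD empty_iff)
    then show False using small unfolding none by simp
  qed
  define b where "b = arg_min_on (prob B) (E - {a})"
  have b: "b \<in> E - {a}" "\<And>x. x \<in> E - {a} \<Longrightarrow> prob B b \<le> prob B x"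
    using arg_min_if_finite(1)[OF _ ne', of "prob B"] arg_min_least[OF _ ne', of _ "prob B"] fin
    by (auto simp: b_def)
  have "prob B b < m"
  proof (rule ccontr)
    assume "\<not> prob B b < m"
    then have "m \<le> prob B x" if "x \<in> E - {a}" for x
      using b(2)[OF that] by linarith
    from sum_bounded_below[of "E - {a}", OF this]
    have "real (card (E - {a})) * m \<le> (\<Sum>x\<in>E - {a}. prob B x)" .
    moreover have "real (card (E - {a})) = real (card E) - 1"
      using card_Suc_Diff1[OF fin(3) a(1)] by linarith
    ultimately show False using small by simp
  qed
  then have "prob B a \<le> prob B x \<and> prob B b \<le> prob B x" if "x \<in> dom B - {a, b}" for x
    using that a b m(2)[of x] by (cases "x \<in> dom X") (force simp: E_def)+
  then show thesis using that[of a b] a(1) b(1) unfolding E_def by blast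
qed

text \<open>Merging continues while the size exceeds the bound. It terminates because the merged
  symbol keeps the name \<open>a\<close> while \<open>b\<close> disappears, and it leaves
  \<open>X\<close> intact because both lie outside \<open>dom X\<close>.\<close>

lemma reduce_to_size_bound:
  assumes X: "dom X \<noteq> {}" and B: "B \<in> extensions X"
  shows "\<exists>B'\<in>extensions_le (size_bound X) X. huffman_redundancy B' \<le> huffman_redundancy B"
  using B
proof (induction "card (dom B)" arbitrary: B rule: less_induct)
  case less
  show ?case
  proof (cases "card (dom B) \<le> size_bound X")
    case True
    then show ?thesis using less.prems by (auto simp: extensions_def extensions_le_def is_source_def)
  next
    case False
    then obtain a b where ab: "a \<in> dom B - dom X" "b \<in> dom B - dom X" "a \<noteq> b"
      and least: "\<And>x. x \<in> dom B - {a, b} \<Longrightarrow> prob B a \<le> prob B x \<and> prob B b \<le> prob B x"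
      using two_small_extra_symbols[OF X less.prems] by (metis not_le)
    define B' where "B' = B(a \<mapsto> prob B a + prob B b, b := None)"
    have src: "is_source B" "X \<subseteq>\<^sub>m B" using less.prems by (auto simp: extensions_def)
    have fin: "finite (dom B)" using src by (simp add: is_source_def)
    \<comment> \<open>A symbol of \<open>X\<close> differs from \<open>a\<close> and
      \<open>b\<close> and so supplies the third symbol that \<open>merge_two_least\<close> asks
      for.\<close>
    obtain x where x: "x \<in> dom X" "x \<in> dom B" 
      using X src map_le_implies_dom_le by blast
    have "card {a, b, x} \<le> card (dom B)" using ab x fin by (intro card_mono) auto
    moreover have "x \<noteq> a" "x \<noteq> b" using ab x by blast+
    ultimately have "3 \<le> card (dom B)" using ab(3) by simp
    note merged = merge_two_least[OF src(1) this _ _ ab(3) least B'_def]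
    have sub: "X \<subseteq>\<^sub>m B'" using src(2) ab by (auto simp: map_le_def B'_def)
    have "dom B' \<subset> dom B" using ab by (auto simp: B'_def)
    then have "card (dom B') < card (dom B)" using fin by (intro psubset_card_mono)
    then show ?thesis using less.hyps[of B'] merged sub ab
      by (force simp: extensions_def)
  qed
qed

section \<open>Attainment of the minimum for bounded size\<close>

text \<open>\<open>V\<close> may contain values unrelated to \<open>S\<close>, so only those with an
  element of \<open>S\<close> at or below them are kept. An element of \<open>S\<close> not above
  the least of these is then a minimum of \<open>S\<close>.\<close>

lemma min_attained_if_finitely_dominated:
  fixes S V :: "real set"
  assumes "S \<noteq> {}" "finite V" and dominated: "\<And>s. s \<in> S \<Longrightarrow> \<exists>v\<in>V. v \<le> s \<and> (\<exists>r\<in>S. r \<le> v)"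
  shows "min_attained S"
proof -
  define V' where "V' = {v\<in>V. \<exists>r\<in>S. r \<le> v}"
  have V': "finite V'" "V' \<noteq> {}" using assms by (auto simp: V'_def)
  obtain r where r: "r \<in> S" "r \<le> Min V'" using Min_in[OF V'] by (auto simp: V'_def)
  have "r \<le> s" if s: "s \<in> S" for s
  proof -
    obtain v where "v \<in> V" "v \<le> s" "\<exists>r\<in>S. r \<le> v" using dominated[OF s] by blast
    then have "v \<in> V'" "v \<le> s" by (simp_all add: V'_def)
    then show ?thesis using r Min_le[OF V'(1)] by force
  qed
  then show ?thesis using r by (auto simp: min_attained_def)
qed

text \<open>\<open>v\<close> is the redundancy of \<open>H\<close> once the extra symbols share
  their mass \<open>t\<close> in proportion to \<open>(1 / 2) ^ length (H e)\<close>. The first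
  claim is the log-sum inequality. For the second, \<open>H\<close> need not be a Huffman code of
  the new source, hence only an inequality.\<close>

lemma improve_extra_probabilities:
  assumes B: "is_source B" "X \<subseteq>\<^sub>m B" and H: "huffman_code B H"
  defines "t \<equiv> 1 - (\<Sum>x\<in>dom X. prob X x)"
  defines "v \<equiv> (\<Sum>x\<in>dom X. prob X x * (real (length (H x)) + log 2 (prob X x)))
      + t * log 2 (t / (\<Sum>e\<in>dom B - dom X. (1 / 2) ^ length (H e)))"
  shows "v \<le> huffman_redundancy B"
    and "\<exists>B'. is_source B' \<and> X \<subseteq>\<^sub>m B' \<and> dom B' = dom B \<and> huffman_redundancy B' \<le> v"
proof -
  define E where "E = dom B - dom X"
  define K where "K = (\<Sum>e\<in>E. (1 / 2 :: real) ^ length (H e))"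
  have sub: "dom X \<subseteq> dom B" using B(2) by (simp add: map_le_implies_dom_le)
  have same: "prob X x = prob B x" if "x \<in> dom X" for x using B(2) that by (simp add: map_le_def)
  have fin: "finite (dom B)" "finite (dom X)" "finite E" 
    using B sub finite_subset by (auto simp: is_source_def E_def)
  have pos: "\<And>x. x \<in> dom B \<Longrightarrow> 0 < prob B x" using B by (auto simp: is_source_def)
  have split: "sum f (dom B) = sum f (dom X) + sum f E" for f :: "'a \<Rightarrow> real"
    using sum.subset_diff[OF sub fin(1), of f] by (simp add: E_def)
  have t: "t = (\<Sum>x\<in>E. prob B x)"
    using B split[of "prob B"] same by (simp add: t_def is_source_def)
  have red: "redundancy H A = (\<Sum>x\<in>dom A. prob A x * (real (length (H x)) + log 2 (prob A x)))" for A
    by (simp add: redundancy_def sum.distrib distrib_left)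
  have log_pow: "log 2 (q / (1 / 2) ^ n) = real n + log 2 q" if "0 < q" for q :: real and n
    using that by (simp add: log_divide log_mult log_nat_power power_one_over)
  have "t * log 2 (t / K) \<le> (\<Sum>e\<in>E. prob B e * log 2 (prob B e / (1 / 2) ^ length (H e)))"
    unfolding t K_def using fin pos by (intro log_sum_inequality) (auto simp: E_def)
  also have "\<dots> = (\<Sum>e\<in>E. prob B e * (real (length (H e)) + log 2 (prob B e)))"
    using pos log_pow by (intro sum.cong) (auto simp: E_def)
  finally show "v \<le> huffman_redundancy B"
    unfolding huffman_redundancy_eq[OF B(1) H] red split v_def using same
    by (simp add: K_def E_def)

  \<comment> \<open>The equality case of the log-sum inequality; the factor \<open>t / K\<close>
    normalises the total of the extra probabilities to \<open>t\<close>.\<close>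
  define B' where "B' x = (if x \<in> E then Some (t / K * (1 / 2) ^ length (H x)) else B x)" for x
  have dom': "dom B' = dom B" by (auto simp: B'_def E_def split: if_splits)
  have ext: "X \<subseteq>\<^sub>m B'" using B(2) by (auto simp: map_le_def B'_def E_def)
  have same': "prob B' x = prob B x" if "x \<in> dom X" for x using that by (simp add: B'_def E_def)
  have probE: "prob B' e = t / K * (1 / 2) ^ length (H e)" if "e \<in> E" for e using that by (simp add: B'_def)
  have tK: "0 < t / K" "0 < t" "0 < K" if "E \<noteq> {}"
    using that fin pos by (auto simp: t K_def E_def intro!: divide_pos_pos sum_pos)
  have sumE: "(\<Sum>e\<in>E. prob B' e) = t"
  proof (cases "E = {}")
    case False
    have "(\<Sum>e\<in>E. prob B' e) = t / K * K"
      unfolding K_def sum_distrib_left using probE by (intro sum.cong) (auto simp: K_def)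
    then show ?thesis using tK(3)[OF False] by simp
  qed (simp add: t)
  have "(\<Sum>b\<in>dom B. prob B' b) = (\<Sum>b\<in>dom B. prob B b)"
    using sumE t same' by (simp add: split)
  moreover have "0 < prob B' x" if "x \<in> dom B" for x
  proof (cases "x \<in> E")
    case True
    then have "0 < t / K" using tK(1) by blast
    then show ?thesis unfolding probE[OF True] by (rule mult_pos_pos) simp
  qed (use that pos in \<open>simp add: B'_def\<close>)
  ultimately have src: "is_source B'" using B by (simp add: is_source_def dom')
  \<comment> \<open>The codeword length cancels against the power in \<open>prob B' e\<close>,
    leaving the constant \<open>log 2 (t / K)\<close>.\<close>
  have "(\<Sum>e\<in>E. prob B' e * (real (length (H e)) + log 2 (prob B' e))) = (\<Sum>e\<in>E. prob B' e * log 2 (t / K))"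
  proof (intro sum.cong refl)
    fix e assume e: "e \<in> E"
    then have "0 < prob B' e" using src by (auto simp: is_source_def dom' E_def)
    from log_pow[OF this, of "length (H e)"]
    show "prob B' e * (real (length (H e)) + log 2 (prob B' e)) = prob B' e * log 2 (t / K)"
      by (simp add: probE[OF e])
  qed
  \<comment> \<open>The sum over \<open>E\<close> collapses to \<open>t * log 2 (t / K)\<close>. If
    \<open>E\<close> is empty then \<open>t = 0\<close>, and the term vanishes whatever the value of
    \<open>t / K\<close>.\<close>
  then have "redundancy H B' = v"
    unfolding red dom' split v_def using same' same
    by (simp add: K_def E_def sumE flip: sum_distrib_right) (simp flip: E_def K_def sumE)
  moreover have "huffman_redundancy B' \<le> redundancy H B'"
    using huffman_redundancy_le[OF src] huffman_code_merging(1)[OF fin(1) H, of "prob B'"]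
    by (simp add: redundancy_def dom')
  ultimately show "\<exists>B'. is_source B' \<and> X \<subseteq>\<^sub>m B' \<and> dom B' = dom B \<and> huffman_redundancy B' \<le> v"
    using src ext dom' by auto
qed

lemma min_attained_extensions_le:
  assumes "extensions_le n X \<noteq> {}"
  shows "min_attained (huffman_redundancy ` extensions_le n X)"
proof (rule min_attained_if_finitely_dominated)
  define t where "t = 1 - (\<Sum>x\<in>dom X. prob X x)"
  define val where "val = (\<lambda>(l, K). (\<Sum>x\<in>dom X. prob X x * (real (l x) + log 2 (prob X x))) + t * log 2 (t / K))"
  \<comment> \<open>All lengths are at most \<open>n\<close>, so the sum of at most \<open>n\<close>
    powers of one half is a multiple of \<open>1 / 2 ^ n\<close> not above \<open>n\<close>. Pairs
    that come from no code are included as well.\<close>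
  let ?V = "val ` ((dom X \<rightarrow>\<^sub>E {..n}) \<times> (\<lambda>j. real j / 2 ^ n) ` {..n * 2 ^ n})"
  show "huffman_redundancy ` extensions_le n X \<noteq> {}" using assms by simp
  have "finite (dom X)"
    using assms finite_dom_sub_source by (auto simp: extensions_le_def)
  then show "finite ?V" by (intro finite_imageI finite_cartesian_product finite_PiE) auto
  fix s assume "s \<in> huffman_redundancy ` extensions_le n X"
  then obtain B where s: "s = huffman_redundancy B" and B: "is_source B" "X \<subseteq>\<^sub>m B"
    and n: "2 \<le> card (dom B)" "card (dom B) \<le> n" by (auto simp: extensions_le_def)
  obtain H where H: "huffman_code B H" using huffman_code_exists B by blast
  have fin: "finite (dom B)" using B by (simp add: is_source_def)
  have sub: "dom X \<subseteq> dom B" using B(2) by (simp add: map_le_implies_dom_le)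
  define E where "E = dom B - dom X"
  define K where "K = (\<Sum>e\<in>E. (1 / 2 :: real) ^ length (H e))"
  define l where "l = restrict (\<lambda>x. length (H x)) (dom X)"
  \<comment> \<open>The numerator of \<open>K\<close> over the denominator \<open>2 ^ n\<close>. The
    subtraction does not truncate, because codeword lengths are at most \<open>n\<close>.\<close>
  define j where "j = (\<Sum>e\<in>E. 2 ^ (n - length (H e)) :: nat)"
  have len: "length (H x) \<le> n" if "x \<in> dom B" for x
    using huffman_code_length[OF fin H that] n by simp
  have "K = real j / 2 ^ n"
    unfolding K_def j_def of_nat_sum sum_divide_distrib
  proof (intro sum.cong refl)
    fix e assume "e \<in> E"
    then have "length (H e) \<le> n" using len by (simp add: E_def)
    then have "(2 :: real) ^ n = 2 ^ length (H e) * 2 ^ (n - length (H e))"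
      by (simp flip: power_add)
    then show "(1 / 2 :: real) ^ length (H e) = real (2 ^ (n - length (H e))) / 2 ^ n"
      unfolding of_nat_power by (simp add: power_one_over)
  qed
  moreover have "j \<le> n * 2 ^ n"
  proof -
    have "j \<le> card E * 2 ^ n" unfolding j_def using sum_bounded_above[of E _ "2 ^ n :: nat"] by simp
    also have "card E \<le> n" using n fin card_mono[of "dom B" E] by (auto simp: E_def)
    finally show ?thesis by simp
  qed
  moreover have "l \<in> dom X \<rightarrow>\<^sub>E {..n}"
    unfolding l_def restrict_PiE_iff using len sub by blast
  ultimately have "val (l, K) \<in> ?V" by (intro imageI SigmaI) simp_all
  moreover have "val (l, K) = (\<Sum>x\<in>dom X. prob X x * (real (length (H x)) + log 2 (prob X x)))
      + t * log 2 (t / (\<Sum>e\<in>dom B - dom X. (1 / 2) ^ length (H e)))" (is "_ = ?v")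
    by (simp add: val_def l_def K_def E_def)
  ultimately have V: "?v \<in> ?V" by simp
  obtain B' where B': "is_source B'" "X \<subseteq>\<^sub>m B'" "dom B' = dom B" "huffman_redundancy B' \<le> ?v"
    using improve_extra_probabilities(2)[OF B H] unfolding t_def by blast
  then have "B' \<in> extensions_le n X" using n by (simp add: extensions_le_def)
  moreover have "?v \<le> s" using improve_extra_probabilities(1)[OF B H] unfolding s t_def .
  ultimately show "\<exists>v\<in>?V. v \<le> s \<and> (\<exists>r\<in>huffman_redundancy ` extensions_le n X. r \<le> v)"
    using V B'(4) by blast
qed

section \<open>Non-empty and empty sub-sources\<close>

theorem theorem2:
  fixes X :: "('a::infinite) \<rightharpoonup> real"
  assumes "\<exists>A. is_source A \<and> X \<subseteq>\<^sub>m A"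
  shows "(card (dom X) \<ge> 1 \<longrightarrow>
           min_attained (huffman_redundancy ` extensions X) \<and>
           min_attained (huffman_redundancy ` extensions_le (size_bound X) X) \<and>
           R_min_star X = R_min_le (size_bound X) X) \<and>
         (card (dom X) = 0 \<longrightarrow>
           min_attained (huffman_redundancy ` extensions X) \<and>
           R_min_star X = 0)"
proof (intro conjI[of "_ \<longrightarrow> _"] impI)
  assume "1 \<le> card (dom X)"
  then have X: "dom X \<noteq> {}" by auto
  let ?S = "huffman_redundancy ` extensions X"
  let ?T = "huffman_redundancy ` extensions_le (size_bound X) X"
  note reduce = reduce_to_size_bound[OF X]
  have "extensions_le (size_bound X) X \<noteq> {}"
    using assms reduce by (auto simp: extensions_def)
  then have T: "min_attained ?T" by (rule min_attained_extensions_le)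
  then obtain r where r: "r \<in> ?T" "\<forall>s\<in>?T. r \<le> s" by (auto simp: min_attained_def)
  have "r \<in> ?S" using r by (auto simp: extensions_def extensions_le_def)
  \<comment> \<open>Every extension has a bounded one of no larger redundancy, so the bounded
    minimum \<open>r\<close> is also the minimum over all extensions.\<close>
  moreover have "\<forall>s\<in>?S. r \<le> s" using r(2) reduce by (fastforce intro: order_trans)
  moreover from calculation have "R_min_star X = r"
    unfolding R_min_star_def by (intro Least_equality) auto
  moreover have "R_min_le (size_bound X) X = r"
    unfolding R_min_le_def using r by (intro Least_equality) auto
  moreover from calculation have "min_attained ?S" unfolding min_attained_def by blast
  ultimately show "min_attained ?S \<and> min_attained ?T \<and> R_min_star X = R_min_le (size_bound X) X"
    using T by simp
next
  assume card: "card (dom X) = 0"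
  have "finite (dom X)"
    using assms finite_dom_sub_source by blast
  then have "X = Map.empty" using card by simp
  obtain a b :: 'a where "a \<noteq> b"
    using infinite_UNIV by (metis (full_types) finite.simps UNIV_eq_I insert_iff)
  note pair = huffman_redundancy_uniform_pair[OF this refl]
  let ?S = "huffman_redundancy ` extensions X"
  have "0 \<in> ?S" using pair \<open>X = Map.empty\<close> by (force simp: extensions_def)
  moreover have "\<forall>s\<in>?S. 0 \<le> s" by (auto simp: extensions_def huffman_redundancy_nonneg)
  moreover from calculation have "R_min_star X = 0"
    unfolding R_min_star_def by (intro Least_equality) auto
  ultimately show "min_attained ?S \<and> R_min_star X = 0"
    unfolding min_attained_def by blast
qed

end
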